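(* Let $\lambda>0$. The distribution $\mu_{1,\lambda}$ of $T_1(\lambda)=A_1+A_1^{\dagger}+\lambda A_1^{\dagger}A_1$ in the vacuum state is the free Meixner law with parameters $(a,b,c,\alpha)=(\lambda,1,1,0)$. Namely, $$ \mu_{1,\lambda}= \begin{cases} \left(1-\frac{1}{\lambda^2}\right)\delta_{-\frac{1}{\lambda}}+\mu_{1,\lambda}^{a.c.} & \text{if } \lambda >1,\\ \mu_{1,\lambda}^{a.c.} & \text{if } 0<\lambda\leq 1, \end{cases} $$ where $\mu_{1,\lambda}^{a.c.}$ is the absolutely continuous part (w.r.t. Lebesgue measure), with density function $$ \mu^{a.c.}_{1,\lambda}(dx)=\frac{\sqrt{4-(x-\lambda)^2}}{2\pi(\lambda x+1)}\chi_{[\lambda-2,\lambda+2]}(x), $$ and the interval $[\lambda-2,\lambda+2]$ in the indicator function of this density of $\mu_{1,\lambda}^{a.c.}$ is replaced by $(-1,3]$ when $\lambda=1$. In addition, for any integer $n\ge 0$, $$ b_{1,n}(\lambda)=\sum_{\varepsilon\in\mathcal{R}(n)}\lambda^{|\varepsilon|_0}, $$ where $b_{1,n}(\lambda)=\langle T_1(\lambda)^n\Omega,\Omega\rangle$ is the $n$-th vacuum moment, $\mathcal{R}(n)$ is the set of Riordan paths of length $n$, and $|\varepsilon|_0$ denotes the number of level-steps in $\varepsilon$.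
   Context: Let $\mathcal{H}$ be a separable Hilbert space with a fixed orthonormal basis $(e_i)_{i\ge1}$. The weakly monotone Fock space is the closed subspace of the full Fock space on $\mathcal{H}$ (with vacuum vector $\Omega=1\oplus 0\oplus\cdots$) spanned by $\Omega$, $\mathcal{H}$ and all simple tensors $e_{i_k}\otimes e_{i_{k-1}}\otimes\cdots\otimes e_{i_1}$ with $i_k\ge i_{k-1}\ge\cdots\ge i_1$, $k\ge2$. For $i\geq 1$, the annihilation operator $A_i$ and the creation operator $A_i^{\dagger}$ are the mutually adjoint bounded operators on it determined by: $A_i\Omega=0$, $A_i e_j=\delta_{i,j}\Omega$, $A_i(e_{i_k}\otimes e_{i_{k-1}}\otimes\cdots\otimes e_{i_1})=\delta_{i,i_k}\,e_{i_{k-1}}\otimes\cdots\otimes e_{i_1}$; $A_i^{\dagger}\Omega=e_i$, $A_i^{\dagger}(e_{i_k}\otimes\cdots\otimes e_{i_1})=e_i\otimes e_{i_k}\otimes\cdots\otimes e_{i_1}$ if $i\ge i_k$ and $0$ otherwise ($k\ge1$). The distribution of a bounded selfadjoint operator $T$ in the vacuum state is the unique probability measure $\mu$ on $\mathbb{R}$ with $\int x^n\,\mu(dx)=\langle T^n\Omega,\Omega\rangle$ for all $n\ge0$. The free Meixner law with parameters $(a,b,c,\alpha)$ ($b,c\ge0$) is the probability measure on $\mathbb{R}$ orthogonalizing the polynomials $P_0(x)=c$, $P_1(x)=x-\alpha$, $P_{n+1}(x)=(x-a)P_n(x)-bP_{n-1}(x)$ for $n\ge1$. A Motzkin path of length $n$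 is a lattice path in $\mathbb{Z}\times\mathbb{Z}$ from $(0,0)$ to $(n,0)$ with up-steps $(1,1)$, down-steps $(1,-1)$ and level-steps $(1,0)$, never passing below the $x$-axis. A Riordan path is a Motzkin path with no level-steps on the $x$-axis. For $n=0$ there is exactly one (empty) path. $\chi_S$ is the indicator function of $S$, and $\delta_x$ the Dirac measure at $x$. *)

theory Defs
  imports "HOL-Probability.Probability" "HOL-Computational_Algebra.Polynomial"
begin

text \<open>
  The libraries only provide real inner product spaces. A complex Hilbert space is a complete
  real inner product space with a compatible complex structure, whose real inner product is the
  real part of the complex one. Positive definiteness of \<open>cinner\<close> and
  \<open>norm x = sqrt (Re (cinner x x))\<close> are inherited from \<^class>\<open>real_inner\<close>.
  The form \<open>cinner\<close> is linear in its first argument.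
\<close>

class chilbert_space = real_inner + complete_space +
  fixes scaleC :: "complex \<Rightarrow> 'a \<Rightarrow> 'a" (infixr \<open>*\<^sub>C\<close> 75)
    and cinner :: "'a \<Rightarrow> 'a \<Rightarrow> complex"
  assumes scaleC_add_right: "c *\<^sub>C (x + y) = c *\<^sub>C x + c *\<^sub>C y"
    and scaleC_add_left: "(c + d) *\<^sub>C x = c *\<^sub>C x + d *\<^sub>C x"
    and scaleC_scaleC: "c *\<^sub>C d *\<^sub>C x = (c * d) *\<^sub>C x"
    and scaleC_of_real: "complex_of_real r *\<^sub>C x = r *\<^sub>R x"
    and cinner_commute: "cinner x y = cnj (cinner y x)"
    and cinner_add_left: "cinner (x + y) z = cinner x z + cinner y z"
    and cinner_scaleC_left: "cinner (c *\<^sub>C x) y = c * cinner x y"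
    and inner_eq_Re_cinner: "inner x y = Re (cinner x y)"

lemma scaleC_one: "1 *\<^sub>C (x :: 'a::chilbert_space) = x"
  using scaleC_of_real[of 1 x] by simp

global_interpretation complex_vector: vector_space "scaleC :: complex \<Rightarrow> 'a \<Rightarrow> 'a::chilbert_space"
  defines cspan = complex_vector.span
  by unfold_locales (simp_all add: scaleC_add_right scaleC_add_left scaleC_scaleC scaleC_one)

definition closed_cspan :: "'a::chilbert_space set \<Rightarrow> 'a set" where
  "closed_cspan S = closure (cspan S)"

text \<open>Orthonormal basis \<open>(e i)\<close> with \<open>i \<ge> 1\<close>; its existence makes the space separable (and
  infinite-dimensional). The value \<open>e 0\<close> is irrelevant.\<close>

definition orthonormal_basis :: "(nat \<Rightarrow> 'h::chilbert_space) \<Rightarrow> bool" where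
  "orthonormal_basis e \<longleftrightarrow>
     (\<forall>i\<ge>1. \<forall>j\<ge>1. cinner (e i) (e j) = (if i = j then 1 else 0)) \<and>
     closed_cspan (e ` {1..}) = UNIV"

definition bounded_operator_on :: "'f::chilbert_space set \<Rightarrow> ('f \<Rightarrow> 'f) \<Rightarrow> bool" where
  "bounded_operator_on M A \<longleftrightarrow>
     (\<forall>x\<in>M. A x \<in> M) \<and>
     (\<forall>x\<in>M. \<forall>y\<in>M. A (x + y) = A x + A y) \<and>
     (\<forall>c. \<forall>x\<in>M. A (c *\<^sub>C x) = c *\<^sub>C A x) \<and>
     (\<exists>K. \<forall>x\<in>M. norm (A x) \<le> K * norm x)"

definition adjoint_on :: "'f::chilbert_space set \<Rightarrow> ('f \<Rightarrow> 'f) \<Rightarrow> ('f \<Rightarrow> 'f) \<Rightarrow> bool" where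
  "adjoint_on M A B \<longleftrightarrow> (\<forall>x\<in>M. \<forall>y\<in>M. cinner (A x) y = cinner x (B y))"

text \<open>
  The full Fock space over \<open>'h\<close> is the Hilbert space direct sum of the Hilbert space tensor powers
  of \<open>'h\<close>. Here it is given by a Hilbert space \<open>'f\<close> together with the map \<open>tens\<close> sending
  \<open>[x\<^sub>k, \<dots>, x\<^sub>1]\<close> to the simple tensor \<open>x\<^sub>k \<otimes> \<cdots> \<otimes> x\<^sub>1\<close>, where \<open>tens []\<close> is the vacuum vector and
  \<open>tens [x]\<close> is \<open>x\<close> itself. The inner products of simple tensors and the totality of the simple
  tensors determine the pair up to a unique unitary isomorphism; in particular multilinearity
  of \<open>tens\<close> and orthogonality of the different degrees are consequences.
\<close>

definition full_fock_space :: "('h::chilbert_space list \<Rightarrow> 'f::chilbert_space) \<Rightarrow> bool" where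
  "full_fock_space tens \<longleftrightarrow>
     (\<forall>xs ys. cinner (tens xs) (tens ys) =
        (if length xs = length ys then \<Prod>k<length xs. cinner (xs ! k) (ys ! k) else 0)) \<and>
     closed_cspan (range tens) = UNIV"

text \<open>Index words \<open>[i\<^sub>k, \<dots>, i\<^sub>1]\<close> with \<open>i\<^sub>k \<ge> \<cdots> \<ge> i\<^sub>1 \<ge> 1\<close>, in the order in which the factors of the
  tensor are written.\<close>

definition wm_word :: "nat list \<Rightarrow> bool" where
  "wm_word w \<longleftrightarrow> sorted_wrt (\<ge>) w \<and> (\<forall>i\<in>set w. i \<ge> 1)"

definition wm_fock_space ::
    "(nat \<Rightarrow> 'h::chilbert_space) \<Rightarrow> ('h list \<Rightarrow> 'f::chilbert_space) \<Rightarrow> 'f set" where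
  "wm_fock_space e tens =
     closed_cspan ({tens []} \<union> {tens [x] | x. True} \<union>
                   {tens (map e w) | w. wm_word w \<and> length w \<ge> 2})"

definition annihilation_creation ::
    "(nat \<Rightarrow> 'h::chilbert_space) \<Rightarrow> ('h list \<Rightarrow> 'f::chilbert_space) \<Rightarrow> nat \<Rightarrow>
     ('f \<Rightarrow> 'f) \<Rightarrow> ('f \<Rightarrow> 'f) \<Rightarrow> bool" where
  "annihilation_creation e tens i A Ad \<longleftrightarrow>
     bounded_operator_on (wm_fock_space e tens) A \<and>
     bounded_operator_on (wm_fock_space e tens) Ad \<and>
     adjoint_on (wm_fock_space e tens) A Ad \<and>
     A (tens []) = 0 \<and>
     (\<forall>j w. wm_word (j # w) \<longrightarrow>
        A (tens (map e (j # w))) = (if i = j then tens (map e w) else 0)) \<and>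
     Ad (tens []) = tens [e i] \<and>
     (\<forall>j w. wm_word (j # w) \<longrightarrow>
        Ad (tens (map e (j # w))) = (if i \<ge> j then tens (map e (i # j # w)) else 0))"

definition prob_on_reals :: "real measure \<Rightarrow> bool" where
  "prob_on_reals \<mu> \<longleftrightarrow> prob_space \<mu> \<and> sets \<mu> = sets borel"

definition distribution_in_state :: "'f::chilbert_space \<Rightarrow> ('f \<Rightarrow> 'f) \<Rightarrow> real measure \<Rightarrow> bool" where
  "distribution_in_state \<Omega> T \<mu> \<longleftrightarrow>
     prob_on_reals \<mu> \<and>
     (\<forall>n. integrable \<mu> (\<lambda>x. x ^ n) \<and>
          complex_of_real (\<integral>x. x ^ n \<partial>\<mu>) = cinner ((T ^^ n) \<Omega>) \<Omega>)"

fun meixner_poly :: "real \<Rightarrow> real \<Rightarrow> real \<Rightarrow> real \<Rightarrow> nat \<Rightarrow> real poly" where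
  "meixner_poly a b c \<alpha> 0 = [:c:]"
| "meixner_poly a b c \<alpha> (Suc 0) = [:- \<alpha>, 1:]"
| "meixner_poly a b c \<alpha> (Suc (Suc n)) =
     [:- a, 1:] * meixner_poly a b c \<alpha> (Suc n) - smult b (meixner_poly a b c \<alpha> n)"

text \<open>A relation, because the orthogonality conditions determine \<open>\<mu>\<close> only for \<open>c > 0\<close>: for \<open>c = 0\<close>
  the constant polynomial is \<open>0\<close>.\<close>

definition free_meixner_law :: "real \<Rightarrow> real \<Rightarrow> real \<Rightarrow> real \<Rightarrow> real measure \<Rightarrow> bool" where
  "free_meixner_law a b c \<alpha> \<mu> \<longleftrightarrow>
     b \<ge> 0 \<and> c \<ge> 0 \<and> prob_on_reals \<mu> \<and>
     (\<forall>n. integrable \<mu> (\<lambda>x. x ^ n)) \<and>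
     (\<forall>m n. m \<noteq> n \<longrightarrow>
        (\<integral>x. poly (meixner_poly a b c \<alpha> m) x * poly (meixner_poly a b c \<alpha> n) x \<partial>\<mu>) = 0)"

text \<open>\<open>\<nu>\<close> is the absolutely continuous part in the Lebesgue decomposition \<open>\<mu> = \<nu> + \<sigma>\<close> of \<open>\<mu>\<close>,
  with \<open>\<sigma>\<close> concentrated on a Lebesgue null set \<open>N\<close>.\<close>

definition abs_continuous_part :: "real measure \<Rightarrow> real measure \<Rightarrow> bool" where
  "abs_continuous_part \<mu> \<nu> \<longleftrightarrow>
     sets \<nu> = sets borel \<and> absolutely_continuous lborel \<nu> \<and>
     (\<exists>\<sigma>. sets \<sigma> = sets borel \<and>
          (\<exists>N\<in>null_sets lborel. emeasure \<sigma> (UNIV - N) = 0) \<and>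
          (\<forall>B\<in>sets borel. emeasure \<mu> B = emeasure \<nu> B + emeasure \<sigma> B))"

datatype step = Up | Down | Level

primrec rise :: "step \<Rightarrow> int" where
  "rise Up = 1"
| "rise Down = - 1"
| "rise Level = 0"

text \<open>A lattice path from the origin is encoded by its list of steps; \<open>height p k\<close> is the ordinate
  of its point with abscissa \<open>k\<close>.\<close>

definition height :: "step list \<Rightarrow> nat \<Rightarrow> int" where
  "height p k = (\<Sum>s\<leftarrow>take k p. rise s)"

definition motzkin_paths :: "nat \<Rightarrow> step list set" where
  "motzkin_paths n = {p. length p = n \<and> height p n = 0 \<and> (\<forall>k\<le>n. height p k \<ge> 0)}"

definition riordan_paths :: "nat \<Rightarrow> step list set" where
  "riordan_paths n = {p \<in> motzkin_paths n. \<forall>k<n. \<not> (p ! k = Level \<and> height p k = 0)}"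

definition level_steps :: "step list \<Rightarrow> nat" where
  "level_steps p = count_list p Level"

text \<open>So \<open>\<Sum>p\<in>riordan_paths n. _\<close> is a genuine sum (sums over infinite sets are \<open>0\<close> by convention).\<close>

lemma finite_riordan_paths: "finite (riordan_paths n)"
proof -
  have "UNIV = {Up, Down, Level}"
    using step.exhaust by blast
  then have "finite (UNIV :: step set)"
    by (metis finite.simps)
  from finite_lists_length_eq[OF this, of n] show ?thesis
    by (rule rev_finite_subset) (auto simp: riordan_paths_def motzkin_paths_def)
qed

end

theory Submission
  imports Defs
begin

text \<open>
  Everything is governed by one array of numbers. For \<open>l > 0\<close> let \<open>W n k\<close> (below
  \<open>prefix_weight l n k\<close>) be the total weight of the lattice paths from height \<open>0\<close> to height \<open>k\<close> in
  \<open>n\<close> steps that stay nonnegative and have no level step at height \<open>0\<close>, each level step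
  contributing a factor \<open>l\<close>. Removing the last step shows that \<open>W\<close> arises by iterating the Jacobi
  matrix with diagonal \<open>0, l, l, \<dots>\<close> and off-diagonal entries \<open>1\<close>. Two other objects obey the
  same recurrence, hence coincide with \<open>W\<close>.

  \<^item> The operator \<open>T = A + A\<^sup>\<dagger> + l A\<^sup>\<dagger>A\<close> acts on the vectors \<open>v\<^sub>k = e\<^sub>1 \<otimes> \<cdots> \<otimes> e\<^sub>1\<close> by exactly this matrix,
    and it is symmetric, so \<open>\<langle>T\<^sup>n\<Omega>, v\<^sub>k\<rangle> = W n k\<close>. With \<open>k = 0\<close> this is the sum over Riordan paths
    (\<open>vacuum_correlation_eq_prefix_weight\<close>).

  \<^item> The Meixner polynomials satisfy \<open>x P\<^sub>k = P\<^sub>k\<^sub>+\<^sub>1 + l P\<^sub>k + P\<^sub>k\<^sub>-\<^sub>1\<close> for \<open>k \<ge> 1\<close>, and \<open>x P\<^sub>0 = P\<^sub>1\<close>.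
    For a measure with all moments, the numbers \<open>\<integral> x\<^sup>j P\<^sub>k\<close> are therefore determined by the column of
    moments (\<open>k = 0\<close>), and also by the row of the means of the \<open>P\<^sub>k\<close> (\<open>j = 0\<close>). Consequently such a probability measure orthogonalizes the \<open>P\<^sub>k\<close>
    iff its moments are \<open>W n 0\<close> iff the means of all \<open>P\<^sub>k\<close> with \<open>k \<ge> 1\<close> vanish
    (\<open>free_meixner_law_iff_moments\<close>, \<open>integral_power_meixner_from_means\<close>).

  Since \<open>W n 0 \<le> (2 + l)\<^sup>n\<close>, the characteristic function is the power series of the moments, so that at
  most one probability measure has these moments (\<open>moments_determine_measure\<close>). It remains to check
  that the explicit measure has vanishing means of \<open>P\<^sub>k\<close>, \<open>k \<ge> 1\<close> (\<open>meixner_measure_means\<close>).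

  Put \<open>x = l + 2 cos \<theta>\<close> with \<open>\<theta> \<in> [-\<pi>, 0]\<close>. The density becomes \<open>(2/\<pi>) sin\<^sup>2\<theta> / (l x + 1)\<close>, and
  \<open>l P\<^sub>n\<^sub>+\<^sub>1 + P\<^sub>n = (l x + 1) U\<^sub>n\<close> for the Chebyshev polynomials \<open>U\<^sub>n\<close> of the second kind, taken at \<open>(x - l)/2 = cos \<theta>\<close>. The
  factor \<open>l x + 1\<close> cancels, and orthogonality of the sines gives \<open>l Q\<^sub>n\<^sub>+\<^sub>1 + Q\<^sub>n = \<delta>\<^sub>n\<^sub>,\<^sub>0\<close> for the means \<open>Q\<^sub>n\<close>
  of \<open>P\<^sub>n\<close> under the density alone. The possible atom sits at the zero \<open>-1/l\<close> of \<open>l x + 1\<close>, so adding it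
  does not change this recurrence. Hence all means with \<open>n \<ge> 1\<close> vanish as soon as the total mass is \<open>1\<close>.
  The mass \<open>Q\<^sub>0\<close> of the density also comes from the recurrence: if \<open>l < 1\<close>, the bounded sequence \<open>Q\<^sub>n\<close>
  grows by the factor \<open>-1/l\<close> at each step from \<open>n = 1\<close> on, so \<open>Q\<^sub>1 = 0\<close> and \<open>Q\<^sub>0 = 1\<close>. The case \<open>l > 1\<close>
  reduces to \<open>1/l\<close>, and for \<open>l = 1\<close> the quotient simplifies to a multiple of
  \<open>1 - cos \<theta>\<close>.
\<close>

section \<open>Weights of Riordan prefixes\<close>

definition riordan_prefixes :: "nat \<Rightarrow> nat \<Rightarrow> step list set" where
  "riordan_prefixes n k =
     {p. length p = n \<and> height p n = int k \<and> (\<forall>j\<le>n. height p j \<ge> 0) \<and>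
         (\<forall>j<n. \<not> (p ! j = Level \<and> height p j = 0))}"

definition prefix_weight :: "real \<Rightarrow> nat \<Rightarrow> nat \<Rightarrow> real" where
  "prefix_weight l n k = (\<Sum>p\<in>riordan_prefixes n k. l ^ level_steps p)"

lemma riordan_prefixes_zero: "riordan_prefixes n 0 = riordan_paths n"
  by (auto simp: riordan_prefixes_def riordan_paths_def motzkin_paths_def)

lemma finite_riordan_prefixes: "finite (riordan_prefixes n k)"
proof -
  have "UNIV = {Up, Down, Level}"
    using step.exhaust by blast
  then have "finite (UNIV :: step set)"
    by (metis finite.simps)
  from finite_lists_length_eq[OF this, of n] show ?thesis
    by (rule rev_finite_subset) (auto simp: riordan_prefixes_def)
qed

lemma height_snoc:
  "j \<le> length p \<Longrightarrow> height (p @ [s]) j = height p j"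
  "height (p @ [s]) (Suc (length p)) = height p (length p) + rise s"
  by (simp_all add: height_def)

lemma snoc_in_riordan_prefixes:
  "p @ [s] \<in> riordan_prefixes (Suc n) k \<longleftrightarrow>
     (\<exists>i. p \<in> riordan_prefixes n i \<and> int i + rise s = int k \<and> \<not> (s = Level \<and> i = 0))"
  (is "?lhs \<longleftrightarrow> ?rhs")
proof
  assume L: ?lhs
  then have len: "length p = n" and fin: "height p n + rise s = int k"
    using height_snoc(2)[of p s] by (auto simp: riordan_prefixes_def)
  have pos: "height p j \<ge> 0" if "j \<le> n" for j
  proof -
    have "height (p @ [s]) j \<ge> 0"
      using L that by (simp add: riordan_prefixes_def)
    with that len show ?thesis by (simp add: height_snoc(1))
  qed
  have lev: "\<not> ((p @ [s]) ! j = Level \<and> height p j = 0)" if "j \<le> n" for j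
  proof -
    have "\<not> ((p @ [s]) ! j = Level \<and> height (p @ [s]) j = 0)"
      using L that by (simp add: riordan_prefixes_def)
    with that len show ?thesis by (simp add: height_snoc(1))
  qed
  have inner: "\<not> (p ! j = Level \<and> height p j = 0)" if "j < n" for j
    using lev[of j] that len by (simp add: nth_append)
  have last: "\<not> (s = Level \<and> height p n = 0)"
    using lev[of n] len by (simp add: nth_append)
  show ?rhs
    by (rule exI[of _ "nat (height p n)"])
       (use len fin pos inner last in \<open>auto simp: riordan_prefixes_def\<close>)
next
  assume ?rhs
  then obtain i where i: "p \<in> riordan_prefixes n i" "int i + rise s = int k"
    "\<not> (s = Level \<and> i = 0)"
    by blast
  then have len: "length p = n"
    by (simp add: riordan_prefixes_def)
  with i show ?lhs
    using height_snoc(2)[of p s]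
    by (auto simp: riordan_prefixes_def height_snoc(1) nth_append le_Suc_eq less_Suc_eq)
qed

text \<open>
  The last step arrives at the prescribed height from a neighbouring height or from the same one; at
  height \<open>0\<close> only a down-step can do so. This is the Jacobi matrix in combinatorial form.
\<close>

lemma riordan_prefixes_Suc:
  "riordan_prefixes (Suc n) 0 = (\<lambda>p. p @ [Down]) ` riordan_prefixes n 1"
  "riordan_prefixes (Suc n) (Suc k) =
     (\<lambda>p. p @ [Up]) ` riordan_prefixes n k \<union>
     ((\<lambda>p. p @ [Level]) ` riordan_prefixes n (Suc k) \<union>
      (\<lambda>p. p @ [Down]) ` riordan_prefixes n (Suc (Suc k)))"
proof -
  have snoc: "\<exists>p s. q = p @ [s]" if "q \<in> riordan_prefixes (Suc n) j" for q j
    using that by (cases q rule: rev_cases) (auto simp: riordan_prefixes_def)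
  have Up: "p @ [Up] \<in> riordan_prefixes (Suc n) j \<longleftrightarrow>
      (\<exists>i. j = Suc i \<and> p \<in> riordan_prefixes n i)" for p j
  proof -
    have "int i + rise Up = int j \<longleftrightarrow> j = Suc i" for i by auto
    then show ?thesis unfolding snoc_in_riordan_prefixes by auto
  qed
  have Down: "p @ [Down] \<in> riordan_prefixes (Suc n) j \<longleftrightarrow> p \<in> riordan_prefixes n (Suc j)" for p j
  proof -
    have "int i + rise Down = int j \<longleftrightarrow> i = Suc j" for i by auto
    then show ?thesis unfolding snoc_in_riordan_prefixes by auto
  qed
  have Level: "p @ [Level] \<in> riordan_prefixes (Suc n) j \<longleftrightarrow> p \<in> riordan_prefixes n j \<and> j \<noteq> 0" for p j
    unfolding snoc_in_riordan_prefixes by auto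
  show "riordan_prefixes (Suc n) 0 = (\<lambda>p. p @ [Down]) ` riordan_prefixes n 1"
  proof (intro equalityI subsetI)
    fix q assume q: "q \<in> riordan_prefixes (Suc n) 0"
    then obtain p s where "q = p @ [s]" using snoc by blast
    with q show "q \<in> (\<lambda>p. p @ [Down]) ` riordan_prefixes n 1"
      by (cases s) (auto simp: Up Down Level)
  qed (auto simp: Down)
  show "riordan_prefixes (Suc n) (Suc k) =
     (\<lambda>p. p @ [Up]) ` riordan_prefixes n k \<union>
     ((\<lambda>p. p @ [Level]) ` riordan_prefixes n (Suc k) \<union>
      (\<lambda>p. p @ [Down]) ` riordan_prefixes n (Suc (Suc k)))"
  proof (intro equalityI subsetI)
    fix q assume q: "q \<in> riordan_prefixes (Suc n) (Suc k)"
    then obtain p s where "q = p @ [s]" using snoc by blast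
    with q show "q \<in> (\<lambda>p. p @ [Up]) ` riordan_prefixes n k \<union>
     ((\<lambda>p. p @ [Level]) ` riordan_prefixes n (Suc k) \<union>
      (\<lambda>p. p @ [Down]) ` riordan_prefixes n (Suc (Suc k)))"
      by (cases s) (auto simp: Up Down Level)
  qed (auto simp: Up Down Level)
qed

lemma level_steps_snoc:
  "level_steps (p @ [s]) = level_steps p + (if s = Level then 1 else 0)"
  by (simp add: level_steps_def)

lemma prefix_weight_0: "prefix_weight l 0 k = (if k = 0 then 1 else 0)"
proof -
  have "riordan_prefixes 0 k = (if k = 0 then {[]} else {})"
    by (auto simp: riordan_prefixes_def height_def)
  then show ?thesis
    by (simp add: prefix_weight_def level_steps_def)
qed

lemma prefix_weight_Suc_0: "prefix_weight l (Suc n) 0 = prefix_weight l n 1"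
  unfolding prefix_weight_def riordan_prefixes_Suc
  by (subst sum.reindex) (auto simp: level_steps_snoc inj_on_def)

lemma prefix_weight_Suc_Suc:
  "prefix_weight l (Suc n) (Suc k) =
     prefix_weight l n k + l * prefix_weight l n (Suc k) + prefix_weight l n (Suc (Suc k))"
  unfolding prefix_weight_def riordan_prefixes_Suc
  by (subst sum.union_disjoint, (auto simp: finite_riordan_prefixes)[3])+
     (simp add: sum.reindex inj_on_def level_steps_snoc sum_distrib_left)

lemma prefix_weight_nonneg: "l \<ge> 0 \<Longrightarrow> prefix_weight l n k \<ge> 0"
  by (simp add: prefix_weight_def sum_nonneg)

text \<open>
  From each height there are at most an up-step, a down-step and a level step, of total weight
  \<open>2 + l\<close>.
\<close>

lemma prefix_weight_le: "l \<ge> 0 \<Longrightarrow> prefix_weight l n k \<le> (2 + l) ^ n"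
proof (induction n arbitrary: k)
  case 0
  then show ?case by (simp add: prefix_weight_0)
next
  case (Suc n)
  have "prefix_weight l (Suc n) k \<le> (2 + l) * (2 + l) ^ n"
  proof (cases k)
    case 0
    have "1 * (2 + l) ^ n \<le> (2 + l) * (2 + l) ^ n"
      using Suc.prems by (intro mult_right_mono) auto
    with Suc.IH[OF Suc.prems, of 1] show ?thesis
      by (simp add: 0 prefix_weight_Suc_0)
  next
    case (Suc j)
    have "l * prefix_weight l n (Suc j) \<le> l * (2 + l) ^ n"
      using Suc.IH[OF Suc.prems] Suc.prems by (intro mult_left_mono) auto
    with Suc.IH[OF Suc.prems, of j] Suc.IH[OF Suc.prems, of "Suc (Suc j)"] show ?thesis
      by (simp add: Suc prefix_weight_Suc_Suc algebra_simps)
  qed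
  then show ?case by simp
qed

section \<open>Vacuum correlations in the weakly monotone Fock space\<close>

lemma cinner_add_right: "cinner x (y + z) = cinner x y + cinner x z"
  for x :: "'a::chilbert_space"
  by (metis cinner_add_left cinner_commute complex_cnj_add)

lemma cinner_scaleR_left: "cinner (r *\<^sub>R x) y = complex_of_real r * cinner x y"
  for x :: "'a::chilbert_space"
  by (metis cinner_scaleC_left scaleC_of_real)

lemma cinner_scaleR_right: "cinner x (r *\<^sub>R y) = complex_of_real r * cinner x y"
  for x :: "'a::chilbert_space"
  by (metis cinner_scaleR_left cinner_commute complex_cnj_mult complex_cnj_complex_of_real)

lemma closed_cspan_add_scaleR:
  fixes S :: "'a::chilbert_space set"
  shows "x \<in> closed_cspan S \<Longrightarrow> y \<in> closed_cspan S \<Longrightarrow> x + y \<in> closed_cspan S"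
    and "x \<in> closed_cspan S \<Longrightarrow> r *\<^sub>R x \<in> closed_cspan S"
proof -
  show "x + y \<in> closed_cspan S" if "x \<in> closed_cspan S" "y \<in> closed_cspan S"
  proof -
    from that obtain f g where fg: "\<forall>n. f n \<in> cspan S" "f \<longlonglongrightarrow> x"
        "\<forall>n. g n \<in> cspan S" "g \<longlonglongrightarrow> y"
      unfolding closed_cspan_def closure_sequential by auto
    have "(\<lambda>n. f n + g n) \<longlonglongrightarrow> x + y"
      by (intro tendsto_add fg)
    moreover have "\<And>n. f n + g n \<in> cspan S"
      by (intro complex_vector.span_add) (use fg in auto)
    ultimately show ?thesis
      unfolding closed_cspan_def closure_sequential
      by (intro exI[of _ "\<lambda>n. f n + g n"]) auto
  qed
  show "r *\<^sub>R x \<in> closed_cspan S" if "x \<in> closed_cspan S"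
  proof -
    from that obtain f where f: "\<forall>n. f n \<in> cspan S" "f \<longlonglongrightarrow> x"
      unfolding closed_cspan_def closure_sequential by auto
    have "(\<lambda>n. r *\<^sub>R f n) \<longlonglongrightarrow> r *\<^sub>R x"
      by (intro tendsto_intros f)
    moreover have "\<And>n. r *\<^sub>R f n \<in> cspan S"
      using complex_vector.span_scale[of "f n" S "complex_of_real r" for n] f(1) by (metis scaleC_of_real)
    ultimately show ?thesis
      unfolding closed_cspan_def closure_sequential
      by (intro exI[of _ "\<lambda>n. r *\<^sub>R f n"]) auto
  qed
qed

text \<open>
  The tensor powers of \<open>e\<^sub>1\<close>, starting with the vacuum, span the invariant subspace that \<open>T\<close> generates
  from the vacuum.
\<close>

definition level_vector :: "(nat \<Rightarrow> 'h) \<Rightarrow> ('h list \<Rightarrow> 'f) \<Rightarrow> nat \<Rightarrow> 'f" where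
  "level_vector e tens k = tens (map e (replicate k 1))"

lemma level_vector_in_wm_fock_space:
  "level_vector e tens k \<in> wm_fock_space e tens"
proof -
  consider "k = 0" | "k = 1" | "k \<ge> 2" by linarith
  then have "level_vector e tens k \<in> {tens []} \<union> {tens [x] | x. True} \<union>
                   {tens (map e w) | w. wm_word w \<and> length w \<ge> 2}"
  proof cases
    case 3
    then show ?thesis
      by (auto simp: level_vector_def wm_word_def sorted_wrt_iff_nth_less
          intro!: exI[of _ "replicate k 1"] simp del: map_replicate)
  qed (auto simp: level_vector_def)
  then show ?thesis
    unfolding wm_fock_space_def closed_cspan_def
    by (meson closure_subset complex_vector.span_base subsetD)
qed

text \<open>
  On the tensor powers of \<open>e\<^sub>1\<close> the operator \<open>T\<close> is the Jacobi matrix of the path recurrence: \<open>A\<^sup>\<dagger>A\<close>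
  fixes all of them except the vacuum, which it annihilates, and this is why level steps at height
  \<open>0\<close> are excluded. Moving one factor \<open>T\<close> to the other side of the inner product by symmetry turns
  this into the recurrence of the weights.
\<close>

lemma vacuum_correlation_eq_prefix_weight:
  fixes l :: real
  assumes fock: "full_fock_space tens" and ac: "annihilation_creation e tens 1 A Ad"
    and T_def: "T = (\<lambda>x. A x + Ad x + l *\<^sub>R Ad (A x))"
  shows "cinner ((T ^^ n) (tens [])) (level_vector e tens k) = complex_of_real (prefix_weight l n k)"
proof -
  let ?M = "wm_fock_space e tens"
  let ?v = "level_vector e tens"
  note vM = level_vector_in_wm_fock_space[of e tens]
  have "bounded_operator_on ?M A" "bounded_operator_on ?M Ad" and adjoint: "adjoint_on ?M A Ad"
    using ac unfolding annihilation_creation_def by blast+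
  then have A_M: "A x \<in> ?M" and Ad_M: "Ad x \<in> ?M" if "x \<in> ?M" for x
    using that unfolding bounded_operator_on_def by blast+
  have add_M: "x + y \<in> ?M" and scale_M: "r *\<^sub>R x \<in> ?M" if "x \<in> ?M" "y \<in> ?M" for x y r
    using that closed_cspan_add_scaleR unfolding wm_fock_space_def by blast+
  have T_M: "T x \<in> ?M" if "x \<in> ?M" for x
    unfolding T_def using that by (intro add_M scale_M A_M Ad_M)
  have adj: "cinner (A x) y = cinner x (Ad y)" if "x \<in> ?M" "y \<in> ?M" for x y
    using adjoint that unfolding adjoint_on_def by blast
  then have adj': "cinner (Ad x) y = cinner x (A y)" if "x \<in> ?M" "y \<in> ?M" for x y
    using that by (metis cinner_commute)
  have selfadj: "cinner (T x) y = cinner x (T y)" if "x \<in> ?M" "y \<in> ?M" for x y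
    using that A_M
    by (simp add: T_def cinner_add_left cinner_add_right cinner_scaleR_left cinner_scaleR_right
        adj adj')
  have v0: "?v 0 = tens []" by (simp add: level_vector_def)
  have word: "wm_word (replicate k 1)" for k
    by (auto simp: wm_word_def sorted_wrt_iff_nth_less)
  have A_v0: "A (?v 0) = 0" and Ad_v0: "Ad (?v 0) = ?v 1"
    using ac by (auto simp: level_vector_def annihilation_creation_def)
  have A_v: "A (?v (Suc k)) = ?v k" for k
    using ac word[of "Suc k"] unfolding annihilation_creation_def level_vector_def
    by (metis replicate_Suc)
  have Ad_v: "Ad (?v k) = ?v (Suc k)" for k
  proof (cases k)
    case (Suc j)
    then show ?thesis
      using ac word[of k] unfolding annihilation_creation_def level_vector_def
      by (metis replicate_Suc order_refl)
  qed (simp add: Ad_v0)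
  have zero_M: "0 \<in> ?M"
    using scale_M[OF vM[of 0] vM[of 0], of 0] by simp
  have Ad_0: "Ad 0 = 0"
  proof -
    \<comment> \<open>The adjoint relation at \<open>0\<close>, tested against \<open>Ad 0\<close>, gives norm \<open>0\<close>.\<close>
    have "cinner (Ad 0) (Ad 0) = cinner (0 *\<^sub>R 0) (A (Ad 0))"
      using adj'[OF zero_M Ad_M[OF zero_M]] by simp
    also have "\<dots> = 0"
      unfolding cinner_scaleR_left by simp
    finally show ?thesis
      by (metis inner_eq_Re_cinner inner_eq_zero_iff zero_complex.sel(1))
  qed
  have T_v0: "T (?v 0) = ?v 1"
    by (simp add: T_def A_v0 Ad_v0 Ad_0)
  have T_v: "T (?v (Suc k)) = ?v k + ?v (Suc (Suc k)) + l *\<^sub>R ?v (Suc k)" for k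
    by (simp add: T_def A_v Ad_v)
  have iter_M: "(T ^^ n) (tens []) \<in> ?M" for n
    using vM[of 0] v0 T_M by (induction n) auto
  show ?thesis
  proof (induction n arbitrary: k)
    case 0
    show ?case
      using fock by (auto simp: full_fock_space_def level_vector_def prefix_weight_0)
  next
    case (Suc n)
    have step: "cinner ((T ^^ Suc n) (tens [])) (?v k) = cinner ((T ^^ n) (tens [])) (T (?v k))"
      using selfadj[OF iter_M vM] by simp
    show ?case
      unfolding step
      by (cases k) (simp_all add: T_v0[simplified] T_v cinner_add_right cinner_scaleR_right
          Suc.IH prefix_weight_Suc_0 prefix_weight_Suc_Suc algebra_simps)
  qed
qed

section \<open>Determinacy of measures with geometrically bounded moments\<close>

lemma prob_on_reals_imp_real_distribution: "prob_on_reals \<nu> \<Longrightarrow> real_distribution \<nu>"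
  by (simp add: prob_on_reals_def real_distribution_def real_distribution_axioms_def)

text \<open>
  The Taylor remainder of order \<open>2n\<close> of the characteristic function is controlled by the absolute
  moment of order \<open>2n\<close>. For even order this is the moment itself, so the
  error is at most \<open>2 (\<bar>t\<bar> R)\<^sup>2\<^sup>n / (2n)!\<close>.
\<close>

lemma char_eq_moment_series:
  fixes R :: real
  assumes "real_distribution \<nu>" and int: "\<And>n. integrable \<nu> (\<lambda>x. x ^ n)"
    and bound: "\<And>n. \<bar>\<integral>x. x ^ n \<partial>\<nu>\<bar> \<le> R ^ n"
  shows "(\<lambda>n. \<Sum>k\<le>2 * n. (\<i> * t) ^ k / fact k * complex_of_real (\<integral>x. x ^ k \<partial>\<nu>)) \<longlonglongrightarrow> char \<nu> t"
proof (rule Lim_transform2)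
  interpret real_distribution \<nu> by fact
  let ?s = "\<lambda>n. \<Sum>k\<le>2 * n. (\<i> * t) ^ k / fact k * complex_of_real (\<integral>x. x ^ k \<partial>\<nu>)"
  show "(\<lambda>_. char \<nu> t) \<longlonglongrightarrow> char \<nu> t" by simp
  show "(\<lambda>n. char \<nu> t - ?s n) \<longlonglongrightarrow> 0"
  proof (rule Lim_null_comparison)
    have "norm (char \<nu> t - ?s n) \<le> 2 * ((\<bar>t\<bar> * R) ^ (2 * n) / fact (2 * n))" for n
    proof -
      have "norm (char \<nu> t - ?s n) \<le> (2 * \<bar>t\<bar> ^ (2 * n) / fact (2 * n)) * (\<integral>x. \<bar>x\<bar> ^ (2 * n) \<partial>\<nu>)"
        using char_approx1[of "2 * n" t] int by simp
      also have "\<dots> \<le> (2 * \<bar>t\<bar> ^ (2 * n) / fact (2 * n)) * R ^ (2 * n)"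
        using bound[of "2 * n"] by (intro mult_left_mono) (auto simp: power_even_abs)
      finally show ?thesis
        by (simp only: power_mult_distrib times_divide_eq_left times_divide_eq_right mult.assoc)
    qed
    then show "\<forall>\<^sub>F n in sequentially. norm (char \<nu> t - ?s n) \<le> 2 * ((\<bar>t\<bar> * R) ^ (2 * n) / fact (2 * n))"
      by simp
    have "(\<lambda>n. (\<bar>t\<bar> * R) ^ n / fact n) \<longlonglongrightarrow> 0"
      using summable_LIMSEQ_zero[OF summable_exp[of "\<bar>t\<bar> * R"]] by (simp add: field_simps)
    then have "(\<lambda>n. (\<bar>t\<bar> * R) ^ (2 * n) / fact (2 * n)) \<longlonglongrightarrow> 0"
      by (rule LIMSEQ_subseq_LIMSEQ[unfolded comp_def]) (simp add: strict_mono_def)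
    then show "(\<lambda>n. 2 * ((\<bar>t\<bar> * R) ^ (2 * n) / fact (2 * n))) \<longlonglongrightarrow> 0"
      by (rule tendsto_mult_right_zero)
  qed
qed

lemma moments_determine_measure:
  fixes R :: real
  assumes "prob_on_reals \<mu>" "prob_on_reals \<nu>"
    and int: "\<And>n. integrable \<mu> (\<lambda>x. x ^ n)" "\<And>n. integrable \<nu> (\<lambda>x. x ^ n)"
    and eq: "\<And>n. (\<integral>x. x ^ n \<partial>\<mu>) = (\<integral>x. x ^ n \<partial>\<nu>)"
    and bound: "\<And>n. \<bar>\<integral>x. x ^ n \<partial>\<mu>\<bar> \<le> R ^ n"
  shows "\<mu> = \<nu>"
proof -
  have "real_distribution \<mu>" "real_distribution \<nu>"
    using assms by (simp_all add: prob_on_reals_imp_real_distribution)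
  moreover have "char \<mu> t = char \<nu> t" for t
    using char_eq_moment_series[OF \<open>real_distribution \<mu>\<close> int(1) bound, of t]
      char_eq_moment_series[OF \<open>real_distribution \<nu>\<close> int(2), of R t] bound
    by (simp add: eq LIMSEQ_unique)
  ultimately show ?thesis
    by (intro Levy_uniqueness) auto
qed

section \<open>Moments and orthogonality of the Meixner polynomials\<close>

abbreviation meixner :: "real \<Rightarrow> nat \<Rightarrow> real \<Rightarrow> real" where
  "meixner l n x \<equiv> poly (meixner_poly l 1 1 0 n) x"

lemma degree_meixner_poly: "degree (meixner_poly a 1 1 c n) \<le> n"
proof (induction n rule: induct_nat_012)
  case (ge2 n)
  have "degree ([:- a, 1:] * meixner_poly a 1 1 c (Suc n)) \<le> Suc (Suc n)"
    using degree_mult_le[of "[:- a, 1:]" "meixner_poly a 1 1 c (Suc n)"] ge2 by simp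
  then show ?case
    using ge2 by (auto intro!: degree_diff_le)
qed auto

lemma integrable_poly:
  fixes \<nu> :: "real measure"
  assumes "\<And>n. integrable \<nu> (\<lambda>x. x ^ n)"
  shows "integrable \<nu> (poly p)"
  unfolding poly_altdef[abs_def]
  by (intro Bochner_Integration.integrable_sum integrable_mult_right assms)

lemma mult_meixner:
  "x * meixner l 0 x = meixner l 1 x"
  "x * meixner l (Suc n) x = meixner l n x + l * meixner l (Suc n) x + meixner l (Suc (Suc n)) x"
  by (simp_all add: algebra_simps)

context
  fixes l :: real and \<nu> :: "real measure"
  assumes int: "\<And>n. integrable \<nu> (\<lambda>x. x ^ n)"
begin

lemma integrable_power_meixner: "integrable \<nu> (\<lambda>x. x ^ j * meixner l n x)"
proof -
  have "poly (monom 1 j * meixner_poly l 1 1 0 n) = (\<lambda>x. x ^ j * meixner l n x)"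
    by (simp add: fun_eq_iff poly_monom)
  then show ?thesis
    using integrable_poly[OF int, of "monom 1 j * meixner_poly l 1 1 0 n"] by simp
qed

text \<open>
  The three-term recurrence of the polynomials, read as a recurrence for the array
  \<open>\<integral> x\<^sup>j P\<^sub>n\<close>, is that of the path weights.
\<close>

lemma integral_power_Suc_meixner:
  "(\<integral>x. x ^ Suc j * meixner l 0 x \<partial>\<nu>) = (\<integral>x. x ^ j * meixner l 1 x \<partial>\<nu>)"
  "(\<integral>x. x ^ Suc j * meixner l (Suc n) x \<partial>\<nu>) =
     (\<integral>x. x ^ j * meixner l n x \<partial>\<nu>) + l * (\<integral>x. x ^ j * meixner l (Suc n) x \<partial>\<nu>)
       + (\<integral>x. x ^ j * meixner l (Suc (Suc n)) x \<partial>\<nu>)"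
proof -
  have shift: "x ^ Suc j * y = x ^ j * (x * y)" for x y :: real
    by simp
  show "(\<integral>x. x ^ Suc j * meixner l 0 x \<partial>\<nu>) = (\<integral>x. x ^ j * meixner l 1 x \<partial>\<nu>)"
    unfolding shift mult_meixner ..
  have "x ^ Suc j * meixner l (Suc n) x =
      x ^ j * meixner l n x + l * (x ^ j * meixner l (Suc n) x)
       + x ^ j * meixner l (Suc (Suc n)) x" for x
    unfolding shift mult_meixner by (simp only: distrib_left mult.left_commute)
  then show "(\<integral>x. x ^ Suc j * meixner l (Suc n) x \<partial>\<nu>) =
     (\<integral>x. x ^ j * meixner l n x \<partial>\<nu>) + l * (\<integral>x. x ^ j * meixner l (Suc n) x \<partial>\<nu>)
       + (\<integral>x. x ^ j * meixner l (Suc (Suc n)) x \<partial>\<nu>)"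
    by (simp only: Bochner_Integration.integral_add Bochner_Integration.integrable_add
        integrable_mult_right integrable_power_meixner Bochner_Integration.integral_mult_right_zero)
qed

text \<open>
  The recurrence expresses column \<open>n + 2\<close> of the array through the columns \<open>n\<close> and \<open>n + 1\<close>, so the
  column of moments determines everything.
\<close>

lemma integral_power_meixner_from_moments:
  assumes "\<And>j. (\<integral>x. x ^ j \<partial>\<nu>) = prefix_weight l j 0"
  shows "(\<integral>x. x ^ j * meixner l n x \<partial>\<nu>) = prefix_weight l j n"
proof (induction n arbitrary: j rule: induct_nat_012)
  case 0
  show ?case using assms by simp
next
  case 1
  show ?case
    using assms[of "Suc j"] integral_power_Suc_meixner(1)[of j] by (simp add: prefix_weight_Suc_0)
next
  case (ge2 n)
  show ?case
    using integral_power_Suc_meixner(2)[of j n] unfolding ge2 prefix_weight_Suc_Suc by linarith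
qed

text \<open>
  The same recurrence expresses row \<open>j + 1\<close> through row \<open>j\<close>, so the row of means determines everything,
  in particular the moments.
\<close>

lemma integral_power_meixner_from_means:
  assumes "\<And>n. (\<integral>x. meixner l n x \<partial>\<nu>) = (if n = 0 then 1 else 0)"
  shows "(\<integral>x. x ^ j * meixner l n x \<partial>\<nu>) = prefix_weight l j n"
proof (induction j arbitrary: n)
  case 0
  show ?case using assms by (simp add: prefix_weight_0)
next
  case (Suc j)
  show ?case
    by (cases n) (simp_all only: integral_power_Suc_meixner Suc prefix_weight_Suc_0 prefix_weight_Suc_Suc)
qed

text \<open>
  A path of \<open>j\<close> steps cannot reach a height \<open>n > j\<close>. Hence \<open>P\<^sub>n\<close> is orthogonal to all lower powers of \<open>x\<close>,
  and thus to all polynomials of degree less than \<open>n\<close>.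
\<close>

lemma meixner_orthogonal_from_moments:
  assumes "\<And>j. (\<integral>x. x ^ j \<partial>\<nu>) = prefix_weight l j 0" and "m < n"
  shows "(\<integral>x. meixner l m x * meixner l n x \<partial>\<nu>) = 0"
proof -
  have W: "prefix_weight l j n = 0" if "j < n" for j n
    using that
  proof (induction j arbitrary: n)
    case (Suc j)
    then show ?case by (cases n) (simp_all add: prefix_weight_Suc_Suc)
  qed (simp add: prefix_weight_0)
  let ?p = "meixner_poly l 1 1 0 m"
  have "(\<integral>x. meixner l m x * meixner l n x \<partial>\<nu>) =
      (\<integral>x. (\<Sum>j\<le>degree ?p. coeff ?p j * (x ^ j * meixner l n x)) \<partial>\<nu>)"
    by (subst (1) poly_altdef) (simp add: sum_distrib_right mult.assoc)
  also have "\<dots> = (\<Sum>j\<le>degree ?p. coeff ?p j * (\<integral>x. x ^ j * meixner l n x \<partial>\<nu>))"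
    by (simp add: Bochner_Integration.integral_sum integrable_power_meixner)
  also have "\<dots> = 0"
  proof (rule sum.neutral, intro ballI)
    fix j assume "j \<in> {..degree ?p}"
    then have "j < n"
      using degree_meixner_poly[of l 0 m] \<open>m < n\<close> by simp
    then show "coeff ?p j * (\<integral>x. x ^ j * meixner l n x \<partial>\<nu>) = 0"
      by (simp add: integral_power_meixner_from_moments[OF assms(1)] W)
  qed
  finally show ?thesis .
qed

end

lemma free_meixner_law_iff_moments:
  "free_meixner_law l 1 1 0 \<nu> \<longleftrightarrow>
     prob_on_reals \<nu> \<and>
     (\<forall>n. integrable \<nu> (\<lambda>x. x ^ n) \<and> (\<integral>x. x ^ n \<partial>\<nu>) = prefix_weight l n 0)"
proof (intro iffI)
  assume free: "free_meixner_law l 1 1 0 \<nu>"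
  then have prob: "prob_on_reals \<nu>" and int: "\<And>n. integrable \<nu> (\<lambda>x. x ^ n)"
    and orth: "\<And>m n. m \<noteq> n \<Longrightarrow> (\<integral>x. meixner l m x * meixner l n x \<partial>\<nu>) = 0"
    by (auto simp: free_meixner_law_def)
  interpret prob_space \<nu>
    using prob by (simp add: prob_on_reals_def)
  have "(\<integral>x. meixner l n x \<partial>\<nu>) = (if n = 0 then 1 else 0)" for n
    using orth[of 0 n] prob_space by (cases n) auto
  from integral_power_meixner_from_means[OF int this, of _ 0]
  show "prob_on_reals \<nu> \<and>
     (\<forall>n. integrable \<nu> (\<lambda>x. x ^ n) \<and> (\<integral>x. x ^ n \<partial>\<nu>) = prefix_weight l n 0)"
    using prob int by simp
next
  assume R: "prob_on_reals \<nu> \<and>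
     (\<forall>n. integrable \<nu> (\<lambda>x. x ^ n) \<and> (\<integral>x. x ^ n \<partial>\<nu>) = prefix_weight l n 0)"
  have "(\<integral>x. meixner l m x * meixner l n x \<partial>\<nu>) = 0" if "m \<noteq> n" for m n
    using that meixner_orthogonal_from_moments[of \<nu> l m n] meixner_orthogonal_from_moments[of \<nu> l n m] R
    by (cases m n rule: linorder_cases) (auto simp: mult.commute)
  with R show "free_meixner_law l 1 1 0 \<nu>"
    by (simp add: free_meixner_law_def)
qed

section \<open>The absolutely continuous part in the angular variable\<close>

text \<open>
  The density of the absolutely continuous part in the angle \<open>\<theta>\<close>, where \<open>x = l + 2 cos \<theta>\<close>. The angle
  runs through \<open>[-\<pi>, 0]\<close> because there \<open>x\<close> is increasing. The denominator is \<open>l x + 1\<close>.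
\<close>

definition arc_density :: "real \<Rightarrow> real \<Rightarrow> real" where
  "arc_density l \<theta> = 2 / pi * ((sin \<theta>)\<^sup>2 / (1 + l\<^sup>2 + 2 * l * cos \<theta>)) * indicator {- pi..0} \<theta>"

lemma arc_density_measurable [measurable]: "arc_density l \<in> borel_measurable borel"
  unfolding arc_density_def[abs_def] by measurable

text \<open>
  The right-hand side is \<open>\<bar>l + exp (\<i> \<theta>)\<bar>\<^sup>2\<close>, which is at least the square of the imaginary part. So the angular
  density stays bounded even for \<open>l = 1\<close>, where the density in \<open>x\<close> is unbounded at the left
  endpoint; and wherever the denominator vanishes, the numerator does too.
\<close>

lemma sin_squared_le: "(sin \<theta>)\<^sup>2 \<le> 1 + l\<^sup>2 + 2 * l * cos \<theta>" for l :: real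
proof -
  have "1 + l\<^sup>2 + 2 * l * cos \<theta> = (sin \<theta>)\<^sup>2 + (l + cos \<theta>)\<^sup>2"
    unfolding sin_squared_eq by (simp add: power2_eq_square algebra_simps)
  then show ?thesis by simp
qed

lemma arc_density_bounds: "0 \<le> arc_density l \<theta>" "arc_density l \<theta> \<le> 2 / pi * indicator {- pi..0} \<theta>"
proof -
  have "0 \<le> 1 + l\<^sup>2 + 2 * l * cos \<theta>"
    using sin_squared_le[of \<theta> l] by (meson order_trans zero_le_power2)
  then have "0 \<le> (sin \<theta>)\<^sup>2 / (1 + l\<^sup>2 + 2 * l * cos \<theta>)" "(sin \<theta>)\<^sup>2 / (1 + l\<^sup>2 + 2 * l * cos \<theta>) \<le> 1"
    using sin_squared_le[of \<theta> l] by (auto simp: divide_le_eq_1)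
  then show "0 \<le> arc_density l \<theta>" "arc_density l \<theta> \<le> 2 / pi * indicator {- pi..0} \<theta>"
    unfolding arc_density_def
    by (auto simp: indicator_def simp del: times_divide_eq_left times_divide_eq_right times_divide_times_eq
        intro!: mult_nonneg_nonneg mult_left_le)
qed

lemma integrable_arc_density:
  assumes h: "continuous_on UNIV h"
  shows "integrable lborel (\<lambda>\<theta>. arc_density l \<theta> * h \<theta>)"
proof (rule Bochner_Integration.integrable_bound)
  have [measurable]: "h \<in> borel_measurable borel"
    by (rule borel_measurable_continuous_onI[OF h])
  show "integrable lborel (\<lambda>\<theta>. indicator {- pi..0} \<theta> *\<^sub>R (2 / pi * \<bar>h \<theta>\<bar>))"
    by (intro borel_integrable_compact continuous_intros continuous_on_subset[OF h]) auto
  show "(\<lambda>\<theta>. arc_density l \<theta> * h \<theta>) \<in> borel_measurable lborel"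
    by measurable
  show "AE \<theta> in lborel. norm (arc_density l \<theta> * h \<theta>) \<le> norm (indicator {- pi..0} \<theta> *\<^sub>R (2 / pi * \<bar>h \<theta>\<bar>))"
  proof (rule AE_I2)
    fix \<theta>
    have "arc_density l \<theta> * \<bar>h \<theta>\<bar> \<le> (2 / pi * indicator {- pi..0} \<theta>) * \<bar>h \<theta>\<bar>"
      by (intro mult_right_mono arc_density_bounds) auto
    then show "norm (arc_density l \<theta> * h \<theta>) \<le> norm (indicator {- pi..0} \<theta> *\<^sub>R (2 / pi * \<bar>h \<theta>\<bar>))"
      using arc_density_bounds(1)[of l \<theta>] by (simp add: abs_mult mult_ac)
  qed
qed

text \<open>
  With \<open>\<alpha> = a\<close> the Meixner polynomials are the Chebyshev polynomials of the second kind, shifted by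
  \<open>a\<close> and scaled to the interval \<open>[a - 2, a + 2]\<close>.
\<close>

lemma shifted_chebyshev_times_sin:
  "poly (meixner_poly a 1 1 a n) (a + 2 * cos \<theta>) * sin \<theta> = sin (real (Suc n) * \<theta>)"
proof (induction n rule: induct_nat_012)
  case 1
  show ?case by (simp add: sin_double)
next
  case (ge2 n)
  have "poly (meixner_poly a 1 1 a (Suc (Suc n))) (a + 2 * cos \<theta>) * sin \<theta> =
      2 * cos \<theta> * sin (real (Suc (Suc n)) * \<theta>) - sin (real (Suc n) * \<theta>)"
    using ge2 by (simp add: algebra_simps)
  also have "real (Suc n) * \<theta> = real (Suc (Suc n)) * \<theta> - \<theta>"
    by (simp add: algebra_simps)
  also have "2 * cos \<theta> * sin (real (Suc (Suc n)) * \<theta>) - sin (real (Suc (Suc n)) * \<theta> - \<theta>)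
      = sin (real (Suc (Suc n)) * \<theta> + \<theta>)"
    by (simp only: sin_diff sin_add) (simp add: algebra_simps)
  also have "real (Suc (Suc n)) * \<theta> + \<theta> = real (Suc (Suc (Suc n))) * \<theta>"
    by (simp add: algebra_simps)
  finally show ?case .
qed simp

lemma poly_meixner_poly_Suc_Suc:
  "poly (meixner_poly a 1 1 c (Suc (Suc n))) x =
     (x - a) * poly (meixner_poly a 1 1 c (Suc n)) x - poly (meixner_poly a 1 1 c n) x"
  by (simp add: algebra_simps)

lemma meixner_Suc_eq_chebyshev:
  "meixner l (Suc n) x = poly (meixner_poly l 1 1 l (Suc n)) x + l * poly (meixner_poly l 1 1 l n) x"
proof (induction n rule: induct_nat_012)
  case (ge2 n)
  then show ?case
    unfolding poly_meixner_poly_Suc_Suc by algebra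
qed (simp_all add: algebra_simps)

text \<open>
  This identity removes the denominator of the density. It also makes the left-hand side vanish at
  the position \<open>-1/l\<close> of the atom.
\<close>

lemma meixner_combination_eq_chebyshev:
  "l * meixner l (Suc n) x + meixner l n x = (l * x + 1) * poly (meixner_poly l 1 1 l n) x"
proof (induction n rule: induct_nat_012)
  case (ge2 n)
  then show ?case
    unfolding poly_meixner_poly_Suc_Suc by algebra
qed (simp_all add: algebra_simps)

lemma abs_meixner_times_sin_le:
  assumes "l \<ge> 0"
  shows "\<bar>meixner l n (l + 2 * cos \<theta>) * sin \<theta>\<bar> \<le> 1 + l"
proof (cases n)
  case 0
  have "\<bar>sin \<theta>\<bar> \<le> 1" by (rule abs_sin_le_one)
  with assms have "\<bar>sin \<theta>\<bar> \<le> 1 + l" by linarith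
  then show ?thesis using 0 by simp
next
  case (Suc k)
  have "meixner l n (l + 2 * cos \<theta>) * sin \<theta> = sin (real (Suc (Suc k)) * \<theta>) + l * sin (real (Suc k) * \<theta>)"
    unfolding Suc meixner_Suc_eq_chebyshev distrib_right mult.assoc shifted_chebyshev_times_sin ..
  also have "\<bar>\<dots>\<bar> \<le> \<bar>sin (real (Suc (Suc k)) * \<theta>)\<bar> + l * \<bar>sin (real (Suc k) * \<theta>)\<bar>"
    using abs_triangle_ineq assms by (metis abs_mult abs_of_nonneg)
  also have "\<dots> \<le> 1 + l * 1"
    using assms by (intro add_mono mult_left_mono abs_sin_le_one) auto
  finally show ?thesis by simp
qed

lemma chebyshev_sine_integral:
  "(\<integral>\<theta>. (2 / pi * (sin (real (Suc n) * \<theta>) * sin \<theta>)) * indicator {- pi..0} \<theta> \<partial>lborel) =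
     (if n = 0 then 1 else 0)"
proof -
  define F where "F \<theta> = ((if n = 0 then \<theta> else sin (real n * \<theta>) / real n)
      - sin (real (n + 2) * \<theta>) / real (n + 2)) / pi" for \<theta>
  have "(F has_real_derivative 2 / pi * (sin (real (Suc n) * \<theta>) * sin \<theta>)) (at \<theta>)" for \<theta>
  proof -
    have sine: "((\<lambda>\<theta>. sin (real k * \<theta>) / real k) has_real_derivative cos (real k * \<theta>)) (at \<theta>)"
      if "k > 0" for k
      using that by (auto intro!: derivative_eq_intros)
    have "((\<lambda>\<theta>. if n = 0 then \<theta> else sin (real n * \<theta>) / real n) has_real_derivative
        cos (real n * \<theta>)) (at \<theta>)"
      using sine[of n] by (cases "n = 0") auto
    then have "(F has_real_derivative (cos (real n * \<theta>) - cos (real (n + 2) * \<theta>)) / pi) (at \<theta>)"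
      unfolding F_def by (intro DERIV_cdivide DERIV_diff sine) auto
    moreover have "cos (real n * \<theta>) - cos (real (n + 2) * \<theta>) = 2 * (sin (real (Suc n) * \<theta>) * sin \<theta>)"
    proof -
      have "real n * \<theta> = real (Suc n) * \<theta> - \<theta>" "real (n + 2) * \<theta> = real (Suc n) * \<theta> + \<theta>"
        by (simp_all add: algebra_simps)
      then show ?thesis by (simp only: cos_diff cos_add)
    qed
    ultimately show ?thesis by simp
  qed
  then have "(\<integral>\<theta>. (2 / pi * (sin (real (Suc n) * \<theta>) * sin \<theta>)) * indicator {- pi..0} \<theta> \<partial>lborel) =
      F 0 - F (- pi)"
    by (intro integral_FTC_Icc_real) (auto intro!: continuous_intros)
  moreover have vanish: "sin (real k * - pi) = 0" for k
    using sin_npi[of k] by (simp add: mult_minus_right)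
  then have "F (- pi) = (if n = 0 then - 1 else 0)"
    unfolding F_def vanish by simp
  ultimately show ?thesis by (simp add: F_def)
qed

text \<open>
  The mean of the \<open>n\<close>-th Meixner polynomial under the absolutely continuous part; for \<open>n = 0\<close> its
  mass.
\<close>

definition arc_mean :: "real \<Rightarrow> nat \<Rightarrow> real" where
  "arc_mean l n = (\<integral>\<theta>. arc_density l \<theta> * meixner l n (l + 2 * cos \<theta>) \<partial>lborel)"

lemma integrable_arc_meixner:
  "integrable lborel (\<lambda>\<theta>. arc_density l \<theta> * meixner l n (l + 2 * cos \<theta>))"
  by (intro integrable_arc_density continuous_intros)

lemma arc_mean_recurrence: "l * arc_mean l (Suc n) + arc_mean l n = (if n = 0 then 1 else 0)"
proof -
  have *: "l * (arc_density l \<theta> * meixner l (Suc n) (l + 2 * cos \<theta>))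
      + arc_density l \<theta> * meixner l n (l + 2 * cos \<theta>)
      = (2 / pi * (sin (real (Suc n) * \<theta>) * sin \<theta>)) * indicator {- pi..0} \<theta>" for \<theta>
  proof -
    let ?x = "l + 2 * cos \<theta>" and ?D = "1 + l\<^sup>2 + 2 * l * cos \<theta>"
    let ?U = "poly (meixner_poly l 1 1 l n) (l + 2 * cos \<theta>)"
    have cancel: "(sin \<theta>)\<^sup>2 / ?D * ?D = (sin \<theta>)\<^sup>2"
      using sin_squared_le[of \<theta> l] zero_le_power2[of "sin \<theta>"] by (cases "?D = 0") auto
    have "l * meixner l (Suc n) ?x + meixner l n ?x = ?D * ?U"
      unfolding meixner_combination_eq_chebyshev by (simp add: power2_eq_square algebra_simps)
    then have "(sin \<theta>)\<^sup>2 / ?D * (l * meixner l (Suc n) ?x + meixner l n ?x) =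
        ((sin \<theta>)\<^sup>2 / ?D * ?D) * ?U"
      by (simp only: mult.assoc)
    also have "\<dots> = (?U * sin \<theta>) * sin \<theta>"
      unfolding cancel by (simp add: power2_eq_square)
    finally have "(sin \<theta>)\<^sup>2 / ?D * (l * meixner l (Suc n) ?x + meixner l n ?x) =
        sin (real (Suc n) * \<theta>) * sin \<theta>"
      unfolding shifted_chebyshev_times_sin .
    moreover have regroup: "l * (c * q * i * a) + c * q * i * b = c * (q * (l * a + b)) * i"
      for a b c i q :: real
      by (simp add: algebra_simps)
    have "l * (arc_density l \<theta> * meixner l (Suc n) ?x) + arc_density l \<theta> * meixner l n ?x
      = 2 / pi * ((sin \<theta>)\<^sup>2 / ?D * (l * meixner l (Suc n) ?x + meixner l n ?x)) * indicator {- pi..0} \<theta>"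
      unfolding arc_density_def by (rule regroup)
    ultimately show ?thesis by (simp only:)
  qed
  have "l * arc_mean l (Suc n) + arc_mean l n =
      (\<integral>\<theta>. l * (arc_density l \<theta> * meixner l (Suc n) (l + 2 * cos \<theta>))
      + arc_density l \<theta> * meixner l n (l + 2 * cos \<theta>) \<partial>lborel)"
    unfolding arc_mean_def
    by (simp only: Bochner_Integration.integral_add integrable_mult_right integrable_arc_meixner
        Bochner_Integration.integral_mult_right_zero)
  then show ?thesis
    unfolding * chebyshev_sine_integral .
qed

text \<open>
  For \<open>l < 1\<close> the recurrence blows up unless \<open>arc_mean l 1 = 0\<close>, whereas the means are bounded:
  \<open>P\<^sub>n sin \<theta>\<close> is bounded uniformly in \<open>n\<close>, and the denominator is at least \<open>(1 - l)\<^sup>2\<close>.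
\<close>

lemma arc_mass_less_1:
  assumes l: "0 < l" "l < 1"
  shows "arc_mean l 0 = 1"
proof -
  define C where "C = (\<integral>\<theta>. indicator {- pi..0} \<theta> *\<^sub>R (2 / pi * ((1 + l) / (1 - l)\<^sup>2)) \<partial>(lborel :: real measure))"
  have bounded: "\<bar>arc_mean l n\<bar> \<le> C" for n
  proof -
    have "\<bar>arc_mean l n\<bar> \<le> (\<integral>\<theta>. \<bar>arc_density l \<theta> * meixner l n (l + 2 * cos \<theta>)\<bar> \<partial>lborel)"
      unfolding arc_mean_def by (rule integral_abs_bound)
    also have "\<dots> \<le> C"
      unfolding C_def
    proof (rule integral_mono)
      show "integrable lborel (\<lambda>\<theta>. \<bar>arc_density l \<theta> * meixner l n (l + 2 * cos \<theta>)\<bar>)"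
        using integrable_arc_meixner by (rule integrable_abs)
      show "integrable lborel (\<lambda>\<theta>. indicator {- pi..0::real} \<theta> *\<^sub>R (2 / pi * ((1 + l) / (1 - l)\<^sup>2)))"
        by (intro borel_integrable_compact continuous_intros) auto
    next
      fix \<theta> :: real
      let ?D = "1 + l\<^sup>2 + 2 * l * cos \<theta>" and ?P = "meixner l n (l + 2 * cos \<theta>)"
      have "l * (1 + cos \<theta>) \<ge> 0"
        using l by (smt (verit) cos_ge_minus_one mult_nonneg_nonneg)
      then have D: "?D \<ge> (1 - l)\<^sup>2" by (simp add: power2_eq_square algebra_simps)
      have pos: "(1 - l)\<^sup>2 > 0" using l by simp
      have "\<bar>sin \<theta> * (?P * sin \<theta>)\<bar> \<le> 1 * (1 + l)"
        unfolding abs_mult[of "sin \<theta>"]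
        using abs_meixner_times_sin_le[of l n \<theta>] l by (intro mult_mono) auto
      then have "\<bar>(sin \<theta>)\<^sup>2 * ?P\<bar> \<le> 1 + l"
        by (simp add: power2_eq_square mult.assoc mult.commute mult.left_commute)
      then have "\<bar>(sin \<theta>)\<^sup>2 * ?P\<bar> / ?D \<le> (1 + l) / (1 - l)\<^sup>2"
        using D pos l by (intro frac_le) auto
      then have "\<bar>(sin \<theta>)\<^sup>2 / ?D * ?P\<bar> \<le> (1 + l) / (1 - l)\<^sup>2"
        using D pos by (simp add: abs_mult abs_of_pos[OF less_le_trans[OF pos D]])
      then have "2 / pi * \<bar>(sin \<theta>)\<^sup>2 / ?D * ?P\<bar> * indicator {- pi..0} \<theta> \<le>
          2 / pi * ((1 + l) / (1 - l)\<^sup>2) * indicator {- pi..0} \<theta>"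
        by (intro mult_right_mono mult_left_mono) auto
      then show "\<bar>arc_density l \<theta> * ?P\<bar> \<le> indicator {- pi..0} \<theta> *\<^sub>R (2 / pi * ((1 + l) / (1 - l)\<^sup>2))"
        by (simp add: arc_density_def abs_mult mult_ac)
    qed
    finally show ?thesis .
  qed
  \<comment> \<open>The recurrence solved backwards: \<open>arc_mean l 1\<close> is a null sequence times a bounded one.\<close>
  have geometric: "arc_mean l 1 = (- l) ^ n * arc_mean l (Suc n)" for n
  proof (induction n)
    case (Suc n)
    have "arc_mean l (Suc n) = - l * arc_mean l (Suc (Suc n))"
      using arc_mean_recurrence[of l "Suc n"] by simp
    with Suc show ?case by simp
  qed simp
  have "(\<lambda>n. arc_mean l 1) \<longlonglongrightarrow> 0"
  proof (rule Lim_null_comparison)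
    have "norm (arc_mean l 1) \<le> l ^ n * C" for n
      using mult_left_mono[OF bounded[of "Suc n"], of "l ^ n"] l
      by (subst geometric[of n]) (simp add: abs_mult power_abs)
    then show "\<forall>\<^sub>F n in sequentially. norm (arc_mean l 1) \<le> l ^ n * C" by simp
    show "(\<lambda>n. l ^ n * C) \<longlonglongrightarrow> 0"
      using l by (intro tendsto_mult_left_zero LIMSEQ_power_zero) auto
  qed
  then have "arc_mean l 1 = 0" by (simp add: LIMSEQ_const_iff)
  then show ?thesis using arc_mean_recurrence[of l 0] by simp
qed

lemma arc_mass_1: "arc_mean 1 0 = 1"
proof -
  have "arc_mean 1 0 = (\<integral>\<theta>. ((1 - cos \<theta>) / pi) * indicator {- pi..0} \<theta> \<partial>lborel)"
    unfolding arc_mean_def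
  proof (rule integral_cong_AE)
    \<comment> \<open>At \<open>-\<pi>\<close> the angular density takes the value \<open>0\<close> of division by zero instead of its limit.\<close>
    have "AE \<theta> in lborel. \<theta> \<noteq> - pi" by (rule AE_lborel_singleton)
    then show "AE \<theta> in lborel. arc_density 1 \<theta> * meixner 1 0 (1 + 2 * cos \<theta>) =
        ((1 - cos \<theta>) / pi) * indicator {- pi..0} \<theta>"
    proof eventually_elim
      case (elim \<theta>)
      have quotient: "(sin \<theta>)\<^sup>2 / (1 + 1\<^sup>2 + 2 * 1 * cos \<theta>) = (1 - cos \<theta>) / 2" if "\<theta> \<in> {- pi..0}"
      proof -
        have "cos pi < cos (- \<theta>)"
          using that elim by (intro cos_monotone_0_pi) auto
        then have "1 + cos \<theta> > 0" by simp
        moreover have "(sin \<theta>)\<^sup>2 = (1 - cos \<theta>) * (1 + cos \<theta>)"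
          unfolding sin_squared_eq by (simp add: power2_eq_square algebra_simps)
        ultimately show ?thesis by (simp add: divide_eq_eq)
      qed
      have "arc_density 1 \<theta> = 2 / pi * ((1 - cos \<theta>) / 2) * indicator {- pi..0} \<theta>"
      proof (cases "\<theta> \<in> {- pi..0}")
        case True
        then show ?thesis unfolding arc_density_def by (simp only: quotient)
      qed (simp add: arc_density_def)
      then show ?case by (simp add: field_simps)
    qed
  qed (rule borel_measurable_integrable[OF integrable_arc_meixner], measurable)
  also have "\<dots> = (0 - sin 0) / pi - ((- pi) - sin (- pi)) / pi"
    by (rule integral_FTC_Icc_real) (auto intro!: derivative_eq_intros continuous_intros)
  finally show ?thesis by simp
qed

text \<open>
  The denominator \<open>\<bar>l + exp (\<i> \<theta>)\<bar>\<^sup>2\<close> is, up to the factor \<open>l\<^sup>2\<close>, invariant under inversion of \<open>l\<close>. This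
  carries the mass from parameters below \<open>1\<close> to those above \<open>1\<close>.
\<close>

lemma arc_mean_0_inverse:
  assumes "l > 0"
  shows "arc_mean (1 / l) 0 = l\<^sup>2 * arc_mean l 0"
proof -
  have "arc_density (1 / l) \<theta> = l\<^sup>2 * arc_density l \<theta>" for \<theta>
  proof -
    have "1 + (1 / l)\<^sup>2 + 2 * (1 / l) * cos \<theta> = (1 + l\<^sup>2 + 2 * l * cos \<theta>) / l\<^sup>2"
      using assms by (simp add: field_simps power2_eq_square)
    then show ?thesis by (simp add: arc_density_def)
  qed
  then show ?thesis by (simp add: arc_mean_def mult.assoc)
qed

lemma arc_mass:
  assumes "l > 0"
  shows "arc_mean l 0 = 1 - max 0 (1 - 1 / l\<^sup>2)"
proof -
  consider "l < 1" | "l = 1" | "l > 1" by linarith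
  then show ?thesis
  proof cases
    case 1
    then have "1 / l\<^sup>2 \<ge> 1" using assms by (simp add: power_le_one)
    with 1 assms show ?thesis by (simp add: arc_mass_less_1)
  next
    case 3
    then have "arc_mean (1 / l) 0 = 1" by (intro arc_mass_less_1) auto
    with arc_mean_0_inverse[OF assms] 3 have "arc_mean l 0 = 1 / l\<^sup>2"
      by (simp add: field_simps)
    with 3 show ?thesis by simp
  qed (simp add: arc_mass_1)
qed

section \<open>The measure with density and atom\<close>

definition atom_mass :: "real \<Rightarrow> real" where
  "atom_mass l = max 0 (1 - 1 / l\<^sup>2)"

text \<open>
  Continuous part and atom together are the image of one density on the line: the angles in
  \<open>[-\<pi>, 0]\<close> carry the continuous part, and the unit interval \<open>(0, 1]\<close>, collapsed to the single point
  \<open>-1/l\<close>, carries the atom. Integrals thereby reduce to Lebesgue integrals of bounded functions of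
  bounded support.
\<close>

definition meixner_measure :: "real \<Rightarrow> real measure" where
  "meixner_measure l =
     distr (density lborel (\<lambda>\<theta>. ennreal (arc_density l \<theta> + atom_mass l * indicator {0<..1} \<theta>)))
       borel (\<lambda>\<theta>. if \<theta> \<le> 0 then l + 2 * cos \<theta> else - 1 / l)"

lemma sets_meixner_measure [simp, measurable_cong]: "sets (meixner_measure l) = sets borel"
  by (simp add: meixner_measure_def)

lemma atom_mass_nonneg: "0 \<le> atom_mass l"
  by (simp add: atom_mass_def)

lemma arc_density_pos_eq_0: "\<theta> > 0 \<Longrightarrow> arc_density l \<theta> = 0"
  by (simp add: arc_density_def)

lemma integral_meixner_measure:
  assumes h: "continuous_on UNIV h"
  shows "integrable (meixner_measure l) h"
    and "(\<integral>x. h x \<partial>meixner_measure l) =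
           (\<integral>\<theta>. arc_density l \<theta> * h (l + 2 * cos \<theta>) \<partial>lborel) + atom_mass l * h (- 1 / l)"
proof -
  let ?\<phi> = "\<lambda>\<theta>. if \<theta> \<le> 0 then l + 2 * cos \<theta> else - 1 / l"
  let ?w = "\<lambda>\<theta>. arc_density l \<theta> + atom_mass l * indicator {0<..1} \<theta>"
  have [measurable]: "h \<in> borel_measurable borel"
    by (rule borel_measurable_continuous_onI[OF h])
  have w: "0 \<le> ?w \<theta>" for \<theta>
    using arc_density_bounds(1)[of l \<theta>] atom_mass_nonneg[of l] by simp
  have split: "?w \<theta> *\<^sub>R h (?\<phi> \<theta>) =
      arc_density l \<theta> * h (l + 2 * cos \<theta>) + (atom_mass l * h (- 1 / l)) * indicator {0<..1} \<theta>" for \<theta>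
    by (cases "\<theta> > 0") (simp_all add: arc_density_pos_eq_0)
  have arc: "integrable lborel (\<lambda>\<theta>. arc_density l \<theta> * h (l + 2 * cos \<theta>))"
    by (intro integrable_arc_density continuous_on_compose2[OF h] continuous_intros) auto
  have atom: "has_bochner_integral lborel (\<lambda>\<theta>. (atom_mass l * h (- 1 / l)) * indicator {0<..1::real} \<theta>)
      (atom_mass l * h (- 1 / l) * 1)"
    using has_bochner_integral_real_indicator[of "{0<..1::real}" lborel]
    by (intro has_bochner_integral_mult_right) simp_all
  show "integrable (meixner_measure l) h"
    unfolding meixner_measure_def
    by (subst integrable_distr_eq, measurable, subst integrable_density)
       (use w arc atom in \<open>auto simp: split has_bochner_integral_iff simp del: real_scaleR_def\<close>)
  show "(\<integral>x. h x \<partial>meixner_measure l) =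
           (\<integral>\<theta>. arc_density l \<theta> * h (l + 2 * cos \<theta>) \<partial>lborel) + atom_mass l * h (- 1 / l)"
    unfolding meixner_measure_def
    by (subst integral_distr, measurable, subst integral_density)
       (use w arc atom in \<open>auto simp: split has_bochner_integral_iff simp del: real_scaleR_def\<close>)
qed

lemma emeasure_meixner_measure_angular:
  assumes [measurable]: "B \<in> sets borel"
  shows "emeasure (meixner_measure l) B =
     (\<integral>\<^sup>+\<theta>. ennreal (arc_density l \<theta>) * indicator B (l + 2 * cos \<theta>) \<partial>lborel) +
     ennreal (atom_mass l) * emeasure (return borel (- 1 / l)) B"
proof -
  let ?\<phi> = "\<lambda>\<theta>. if \<theta> \<le> 0 then l + 2 * cos \<theta> else - 1 / l"
  let ?w = "\<lambda>\<theta>. arc_density l \<theta> + atom_mass l * indicator {0<..1} \<theta>"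
  have "emeasure (meixner_measure l) B = (\<integral>\<^sup>+x. indicator B x \<partial>meixner_measure l)"
    by simp
  also have "\<dots> =
      (\<integral>\<^sup>+\<theta>. indicator B (?\<phi> \<theta>) \<partial>density lborel (\<lambda>\<theta>. ennreal (?w \<theta>)))"
    unfolding meixner_measure_def
    by (rule nn_integral_distr) measurable
  also have "\<dots> = (\<integral>\<^sup>+\<theta>. ennreal (?w \<theta>) * indicator B (?\<phi> \<theta>) \<partial>lborel)"
    by (rule nn_integral_density) measurable
  also have "\<dots> = (\<integral>\<^sup>+\<theta>. ennreal (arc_density l \<theta>) * indicator B (l + 2 * cos \<theta>) +
      ennreal (atom_mass l) * indicator B (- 1 / l) * indicator {0<..1} \<theta> \<partial>lborel)"
  proof (rule nn_integral_cong)
    fix \<theta> :: real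
    show "ennreal (?w \<theta>) * indicator B (?\<phi> \<theta>) =
        ennreal (arc_density l \<theta>) * indicator B (l + 2 * cos \<theta>) +
        ennreal (atom_mass l) * indicator B (- 1 / l) * indicator {0<..1} \<theta>"
      by (cases "\<theta> > 0") (auto simp: arc_density_pos_eq_0 indicator_def)
  qed
  also have "\<dots> = (\<integral>\<^sup>+\<theta>. ennreal (arc_density l \<theta>) * indicator B (l + 2 * cos \<theta>) \<partial>lborel) +
      ennreal (atom_mass l) * indicator B (- 1 / l) * emeasure lborel {0<..1::real}"
    by (subst nn_integral_add) (auto simp: nn_integral_cmult_indicator)
  finally show ?thesis by simp
qed

definition meixner_density :: "real \<Rightarrow> real \<Rightarrow> real" where
  "meixner_density l x = sqrt (4 - (x - l)\<^sup>2) / (2 * pi * (l * x + 1)) *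
     indicator (if l = 1 then {-1<..3} else {l - 2..l + 2}) x"

lemma meixner_density_measurable [measurable]: "meixner_density l \<in> borel_measurable borel"
  unfolding meixner_density_def[abs_def] by measurable

text \<open>
  Substitution \<open>x = l + 2 cos \<theta>\<close>: the square root is \<open>-2 sin \<theta>\<close> and \<open>dx = -2 sin \<theta> d\<theta>\<close>.
\<close>

lemma nn_integral_arc_density_eq:
  assumes [measurable]: "B \<in> sets borel"
  shows "(\<integral>\<^sup>+\<theta>. ennreal (arc_density l \<theta>) * indicator B (l + 2 * cos \<theta>) \<partial>lborel) =
     emeasure (density lborel (\<lambda>x. ennreal (meixner_density l x))) B"
proof -
  let ?g = "\<lambda>\<theta>. l + 2 * cos \<theta>" and ?g' = "\<lambda>\<theta>. - 2 * sin \<theta>"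
  let ?f = "\<lambda>x. meixner_density l x * indicator B x"
  have "emeasure (density lborel (\<lambda>x. ennreal (meixner_density l x))) B =
      (\<integral>\<^sup>+x. ennreal (meixner_density l x) * indicator B x \<partial>lborel)"
    by (rule emeasure_density) measurable
  also have "\<dots> = (\<integral>\<^sup>+x. ennreal (?f x * indicator {?g (- pi)..?g 0} x) \<partial>lborel)"
    by (intro nn_integral_cong) (auto simp: meixner_density_def indicator_def)
  also have "\<dots> = (\<integral>\<^sup>+\<theta>. ennreal (?f (?g \<theta>) * ?g' \<theta> * indicator {- pi..0} \<theta>) \<partial>lborel)"
  proof (rule nn_integral_substitution)
    show "set_borel_measurable borel {?g (- pi)..?g 0} ?f"
      unfolding set_borel_measurable_def by measurable
    show "(?g has_real_derivative ?g' \<theta>) (at \<theta>)" for \<theta>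
      by (auto intro!: derivative_eq_intros)
    show "continuous_on {- pi..0} ?g'"
      by (intro continuous_intros)
    show "?g' \<theta> \<ge> 0" if "\<theta> \<in> {- pi..0}" for \<theta>
      using sin_ge_zero[of "- \<theta>"] that by simp
  qed simp
  also have "\<dots> = (\<integral>\<^sup>+\<theta>. ennreal (arc_density l \<theta>) * indicator B (l + 2 * cos \<theta>) \<partial>lborel)"
  proof (rule nn_integral_cong)
    fix \<theta> :: real
    have "meixner_density l (?g \<theta>) * ?g' \<theta> * indicator {- pi..0} \<theta> = arc_density l \<theta>"
    proof (cases "\<theta> \<in> {- pi..0}")
      case True
      have root: "sqrt (4 - (?g \<theta> - l)\<^sup>2) = - 2 * sin \<theta>"
      proof -
        have "sin (- \<theta>) \<ge> 0" using True by (intro sin_ge_zero) auto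
        moreover have "4 - (?g \<theta> - l)\<^sup>2 = (2 * sin \<theta>)\<^sup>2"
          by (simp add: power_mult_distrib sin_squared_eq)
        ultimately show ?thesis by (simp only: real_sqrt_abs) simp
      qed
      have den: "l * ?g \<theta> + 1 = 1 + l\<^sup>2 + 2 * l * cos \<theta>"
        by (simp add: power2_eq_square algebra_simps)
      have "?g \<theta> \<in> {l - 2..l + 2}"
        using cos_ge_minus_one[of \<theta>] cos_le_one[of \<theta>] by simp
      \<comment> \<open>For \<open>l = 1\<close> the density omits the left endpoint; there both sides are \<open>0\<close>.\<close>
      moreover have "sin \<theta> = 0" if "cos \<theta> = - 1"
        using that sin_cos_squared_add[of \<theta>] by simp
      moreover have "cos \<theta> = - 1 \<or> - 1 < cos \<theta>"
        using cos_ge_minus_one[of \<theta>] by linarith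
      ultimately have "meixner_density l (?g \<theta>) * ?g' \<theta> =
          - 2 * sin \<theta> / (2 * pi * (1 + l\<^sup>2 + 2 * l * cos \<theta>)) * ?g' \<theta>"
        unfolding meixner_density_def root den by (auto simp: indicator_def)
      then show ?thesis
        using True by (simp add: arc_density_def power2_eq_square)
    qed (simp add: arc_density_def)
    then have "?f (?g \<theta>) * ?g' \<theta> * indicator {- pi..0} \<theta> = arc_density l \<theta> * indicator B (?g \<theta>)"
      by (cases "?g \<theta> \<in> B") simp_all
    then show "ennreal (?f (?g \<theta>) * ?g' \<theta> * indicator {- pi..0} \<theta>) = ennreal (arc_density l \<theta>) * indicator B (?g \<theta>)"
      by (simp add: indicator_def)
  qed
  finally show ?thesis ..
qed

lemma emeasure_meixner_measure:
  assumes "B \<in> sets borel"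
  shows "emeasure (meixner_measure l) B =
     ennreal (atom_mass l) * emeasure (return borel (- 1 / l)) B +
     emeasure (density lborel (\<lambda>x. ennreal (meixner_density l x))) B"
  using assms by (simp add: emeasure_meixner_measure_angular nn_integral_arc_density_eq add.commute)

text \<open>
  The combination \<open>l P\<^sub>n\<^sub>+\<^sub>1 + P\<^sub>n\<close> does not see the atom, so the means under the whole measure satisfy the
  recurrence of the means under the continuous part. The atom enters only by completing the mass to
  \<open>1\<close>, which makes the recurrence start with \<open>l M\<^sub>1 + 1 = 1\<close>.
\<close>

lemma meixner_measure_means:
  assumes l: "l > 0"
  shows "(\<integral>x. meixner l n x \<partial>meixner_measure l) = (if n = 0 then 1 else 0)"
proof -
  define M where "M n = (\<integral>x. meixner l n x \<partial>meixner_measure l)" for n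
  have M: "M n = arc_mean l n + atom_mass l * meixner l n (- 1 / l)" for n
    unfolding M_def arc_mean_def by (intro integral_meixner_measure continuous_intros)
  have atom: "l * meixner l (Suc n) (- 1 / l) + meixner l n (- 1 / l) = 0" for n
    unfolding meixner_combination_eq_chebyshev using l by simp
  have rec: "l * M (Suc n) + M n = (if n = 0 then 1 else 0)" for n
  proof -
    have "l * M (Suc n) + M n = (l * arc_mean l (Suc n) + arc_mean l n) +
        atom_mass l * (l * meixner l (Suc n) (- 1 / l) + meixner l n (- 1 / l))"
      unfolding M by (simp only: algebra_simps)
    then show ?thesis by (simp only: atom arc_mean_recurrence mult_zero_right add_0_right)
  qed
  have "M 0 = 1"
    unfolding M arc_mass[OF l] atom_mass_def by simp
  moreover have "M (Suc n) = 0" for n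
  proof (induction n)
    case 0
    show ?case using rec[of 0] \<open>M 0 = 1\<close> l by simp
  next
    case (Suc n)
    then show ?case using rec[of "Suc n"] l by simp
  qed
  ultimately have "M n = (if n = 0 then 1 else 0)"
    by (cases n) simp_all
  then show ?thesis unfolding M_def .
qed

lemma prob_on_reals_meixner_measure:
  assumes "l > 0"
  shows "prob_on_reals (meixner_measure l)"
proof -
  interpret finite_measure "meixner_measure l"
  proof
    have "integrable (meixner_measure l) (\<lambda>x. 1 :: real)"
      by (intro integral_meixner_measure continuous_intros)
    then show "emeasure (meixner_measure l) (space (meixner_measure l)) \<noteq> \<infinity>"
      by (simp add: integrable_iff_bounded)
  qed
  have "measure (meixner_measure l) (space (meixner_measure l)) = 1"
    using meixner_measure_means[OF assms, of 0] by simp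
  then have "prob_space (meixner_measure l)"
    by (intro prob_spaceI) (simp add: emeasure_eq_measure)
  then show ?thesis
    by (simp add: prob_on_reals_def)
qed

lemma meixner_measure_moments:
  assumes "l > 0"
  shows "integrable (meixner_measure l) (\<lambda>x. x ^ n)"
    and "(\<integral>x. x ^ n \<partial>meixner_measure l) = prefix_weight l n 0"
proof -
  have int: "integrable (meixner_measure l) (\<lambda>x. x ^ n)" for n
    by (intro integral_meixner_measure continuous_intros)
  then show "integrable (meixner_measure l) (\<lambda>x. x ^ n)" .
  show "(\<integral>x. x ^ n \<partial>meixner_measure l) = prefix_weight l n 0"
    using integral_power_meixner_from_means[OF int meixner_measure_means[OF assms], of n 0] by simp
qed

text \<open>
  Existence and uniqueness in one: the explicit measure solves the moment problem of the Riordan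
  weights, and the exponential bound on these weights makes the problem determinate.
\<close>

lemma eq_meixner_measure_iff_moments:
  assumes l: "l > 0"
  shows "\<nu> = meixner_measure l \<longleftrightarrow>
     prob_on_reals \<nu> \<and>
     (\<forall>n. integrable \<nu> (\<lambda>x. x ^ n) \<and> (\<integral>x. x ^ n \<partial>\<nu>) = prefix_weight l n 0)"
proof
  assume R: "prob_on_reals \<nu> \<and>
     (\<forall>n. integrable \<nu> (\<lambda>x. x ^ n) \<and> (\<integral>x. x ^ n \<partial>\<nu>) = prefix_weight l n 0)"
  then have "\<bar>\<integral>x. x ^ n \<partial>\<nu>\<bar> \<le> (2 + l) ^ n" for n
    using prefix_weight_nonneg[of l n 0] prefix_weight_le[of l n 0] l by simp
  then show "\<nu> = meixner_measure l"
    using R prob_on_reals_meixner_measure[OF l] meixner_measure_moments[OF l]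
    by (intro moments_determine_measure[of \<nu> _ "2 + l"]) auto
qed (use prob_on_reals_meixner_measure meixner_measure_moments l in auto)

lemma abs_continuous_part_meixner_measure:
  "abs_continuous_part (meixner_measure l) (density lborel (\<lambda>x. ennreal (meixner_density l x)))"
  unfolding abs_continuous_part_def
proof (intro conjI exI[of _ "scale_measure (ennreal (atom_mass l)) (return borel (- 1 / l))"] ballI
    bexI[of _ "{- 1 / l}"])
  show "absolutely_continuous lborel (density lborel (\<lambda>x. ennreal (meixner_density l x)))"
    by (rule absolutely_continuousI_density) measurable
qed (auto simp: emeasure_meixner_measure add.commute)

section \<open>The vacuum distribution\<close>

theorem theorem3p1:
  fixes e :: "nat \<Rightarrow> 'h::chilbert_space"
    and tens :: "'h list \<Rightarrow> 'f::chilbert_space"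
    and A Ad :: "nat \<Rightarrow> 'f \<Rightarrow> 'f"
    and lam :: real
    and \<Omega> :: 'f
    and T :: "'f \<Rightarrow> 'f"
    and dens :: "real \<Rightarrow> real"
  assumes "orthonormal_basis e"
    and "full_fock_space tens"
    and "\<And>i. i \<ge> 1 \<Longrightarrow> annihilation_creation e tens i (A i) (Ad i)"
    and "lam > 0"
  defines "\<Omega> \<equiv> tens []"
    and "T \<equiv> (\<lambda>x. A 1 x + Ad 1 x + lam *\<^sub>R Ad 1 (A 1 x))"
    and "dens \<equiv> (\<lambda>x. sqrt (4 - (x - lam)\<^sup>2) / (2 * pi * (lam * x + 1)) *
                     indicator (if lam = 1 then {-1<..3} else {lam - 2..lam + 2}) x)"
  shows "(\<exists>\<mu> \<mu>ac.
            (\<forall>\<nu>. distribution_in_state \<Omega> T \<nu> \<longleftrightarrow> \<nu> = \<mu>) \<and>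
            (\<forall>\<nu>. free_meixner_law lam 1 1 0 \<nu> \<longleftrightarrow> \<nu> = \<mu>) \<and>
            abs_continuous_part \<mu> \<mu>ac \<and>
            \<mu>ac = density lborel (\<lambda>x. ennreal (dens x)) \<and>
            (lam > 1 \<longrightarrow> (\<forall>B\<in>sets borel.
               emeasure \<mu> B = ennreal (1 - 1 / lam\<^sup>2) * emeasure (return borel (- 1 / lam)) B
                              + emeasure \<mu>ac B)) \<and>
            (lam \<le> 1 \<longrightarrow> \<mu> = \<mu>ac)) \<and>
         (\<forall>n. cinner ((T ^^ n) \<Omega>) \<Omega> =
            complex_of_real (\<Sum>p\<in>riordan_paths n. lam ^ level_steps p))"
proof -
  have dens: "dens = meixner_density lam"
    by (simp add: fun_eq_iff dens_def meixner_density_def)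
  have moments: "cinner ((T ^^ n) \<Omega>) \<Omega> = complex_of_real (prefix_weight lam n 0)" for n
    using vacuum_correlation_eq_prefix_weight[OF assms(2) assms(3)[OF order_refl], of T lam n 0]
    by (simp add: T_def \<Omega>_def level_vector_def)
  let ?\<mu> = "meixner_measure lam"
  let ?\<mu>ac = "density lborel (\<lambda>x. ennreal (dens x))"
  have "distribution_in_state \<Omega> T \<nu> \<longleftrightarrow> \<nu> = ?\<mu>" for \<nu>
    unfolding eq_meixner_measure_iff_moments[OF \<open>lam > 0\<close>] distribution_in_state_def moments
    by simp
  moreover have "free_meixner_law lam 1 1 0 \<nu> \<longleftrightarrow> \<nu> = ?\<mu>" for \<nu>
    unfolding eq_meixner_measure_iff_moments[OF \<open>lam > 0\<close>] free_meixner_law_iff_moments ..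
  moreover have "abs_continuous_part ?\<mu> ?\<mu>ac"
    unfolding dens by (rule abs_continuous_part_meixner_measure)
  moreover have "emeasure ?\<mu> B = ennreal (1 - 1 / lam\<^sup>2) * emeasure (return borel (- 1 / lam)) B
                              + emeasure ?\<mu>ac B" if "lam > 1" "B \<in> sets borel" for B
  proof -
    have "atom_mass lam = 1 - 1 / lam\<^sup>2"
      using that by (simp add: atom_mass_def)
    then show ?thesis
      using emeasure_meixner_measure[OF that(2), of lam] by (simp add: dens)
  qed
  moreover have "?\<mu> = ?\<mu>ac" if "lam \<le> 1"
  proof (rule measure_eqI)
    fix B assume "B \<in> sets ?\<mu>"
    moreover have "atom_mass lam = 0"
      using that \<open>lam > 0\<close> by (simp add: atom_mass_def power_le_one)
    ultimately show "emeasure ?\<mu> B = emeasure ?\<mu>ac B"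
      by (simp add: emeasure_meixner_measure dens)
  qed simp
  moreover have "cinner ((T ^^ n) \<Omega>) \<Omega> =
      complex_of_real (\<Sum>p\<in>riordan_paths n. lam ^ level_steps p)" for n
    unfolding moments prefix_weight_def riordan_prefixes_zero ..
  ultimately show ?thesis by blast
qed

end
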